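(* Let $p$ be an odd prime and let $g$ be an integer with $g \geq p$. Then there is no smooth hyperelliptic curve $C$ of genus $g$ defined over an algebraically closed field $k$ of characteristic $p$ whose $a$-number $a_C$ equals $g-1$.
   Context: For a smooth projective curve $C$ over an algebraically closed field $k$ of characteristic $p>0$, the $a$-number is $a_C=\dim_k \operatorname{Hom}(\alpha_p, \operatorname{Jac}(C)[p])$, where $\alpha_p=\operatorname{Spec}(k[x]/(x^p))$ is the kernel of Frobenius on the additive group scheme $\mathbb{G}_a$ and $\operatorname{Jac}(C)[p]$ is the $p$-torsion group scheme of the Jacobian. Equivalently, $a_C = g - \operatorname{rank}(A)$, where $A$ is the Cartier–Manin matrix: for a hyperelliptic curve $y^2=f(x)$ with $f$ squarefree of degree $2g+1$ (or $2g+2$), writing $f(x)^{(p-1)/2}=\sum_j \kappa_j x^j$, $A$ is the $g\times g$ matrix with entries $a_{ij}=\kappa_{pi-j}$ (with $\kappa_j=0$ for $j$ out of range). *)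

theory Defs
  imports
    "HOL-Computational_Algebra.Computational_Algebra"
    "Jordan_Normal_Form.DL_Rank"
begin

text \<open>
  In characteristic other than 2, the smooth projective hyperelliptic curves of genus \<open>g\<close> over an
  algebraically closed field are the smooth projective models of the affine equations
  \<open>y\<^sup>2 = f(x)\<close> with \<open>f\<close> squarefree of degree \<open>2 g + 1\<close> or \<open>2 g + 2\<close>. A curve is represented by such an \<open>f\<close>.
\<close>

definition hyperelliptic_equation :: "nat \<Rightarrow> 'k::alg_closed_field poly \<Rightarrow> bool" where
  "hyperelliptic_equation g f \<longleftrightarrow>
     squarefree f \<and> (degree f = 2 * g + 1 \<or> degree f = 2 * g + 2)"

text \<open>
  The entry in row \<open>i\<close> and column \<open>j\<close> (both counted from 1) is the coefficient of \<open>x\<close> to the power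
  \<open>p i - j\<close> in \<open>f\<close> to the power \<open>(p - 1) / 2\<close>, where \<open>p\<close> is the characteristic. Matrices are indexed
  from 0, hence the shift. Subtraction on \<^typ>\<open>nat\<close> truncates, so the case of a negative exponent,
  in which the entry is 0, is separated out; exponents above the degree give 0 by \<^const>\<open>coeff\<close>.
\<close>

definition cartier_manin_entry :: "'k::alg_closed_field poly \<Rightarrow> nat \<Rightarrow> nat \<Rightarrow> 'k" where
  "cartier_manin_entry f i j =
     (if j \<le> CHAR('k) * i then coeff (f ^ ((CHAR('k) - 1) div 2)) (CHAR('k) * i - j) else 0)"

definition cartier_manin_matrix :: "nat \<Rightarrow> 'k::alg_closed_field poly \<Rightarrow> 'k mat" where
  "cartier_manin_matrix g f = mat g g (\<lambda>(i, j). cartier_manin_entry f (i + 1) (j + 1))"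

text \<open>
  The a-number of the curve is the dimension of the space of homomorphisms from the kernel of
  Frobenius on the additive group to the \<open>p\<close>-torsion group scheme of its Jacobian. It is rendered
  here by the formula that computes it for a hyperelliptic curve: the genus minus the rank of the
  Cartier-Manin matrix. The rank is at most \<open>g\<close>, so the subtraction on \<^typ>\<open>nat\<close> does not truncate.
\<close>

definition a_number :: "nat \<Rightarrow> 'k::alg_closed_field poly \<Rightarrow> nat" where
  "a_number g f = g - vec_space.rank g (cartier_manin_matrix g f)"

end

theory Submission
  imports Defs
begin

text \<open>
  Write \<open>f ^ ((p - 1) / 2) = N\<close>. Since \<open>g \<ge> p\<close>, the first \<open>p\<close> columns of the Cartier-Manin matrix
  contain every coefficient of \<open>N\<close>, column \<open>j\<close> being the residue class of \<open>- j\<close> modulo \<open>p\<close>. If the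
  matrix has rank at most 1, then its columns are multiples of one vector \<open>v\<close>, so that
  \<open>N = V(x\<^sup>p) R(x)\<close>, where \<open>V\<close> has coefficient vector \<open>v\<close> and \<open>R\<close> has degree less than \<open>p\<close>. As \<open>k\<close> is
  perfect, \<open>V(x\<^sup>p) = W ^ p\<close>; but the roots of \<open>N\<close> have multiplicity \<open>(p - 1) / 2 < p\<close>, so \<open>W\<close> is
  constant and \<open>N\<close> has degree less than \<open>p\<close>, which contradicts \<open>deg f > 2\<close>.
\<close>

text \<open>A nonzero column \<open>u\<close> spans the column space: a column \<open>c\<close>
  independent of it would force the rank up to 2.\<close>

lemma (in vec_space) rank_le_1_cols_proportional:
  assumes A: "A \<in> carrier_mat n nc" and rank: "rank A \<le> 1"
  obtains v b where "\<And>i j. i < n \<Longrightarrow> j < nc \<Longrightarrow> A $$ (i, j) = b j * v i"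
proof (cases "\<exists>l<nc. col A l \<noteq> 0\<^sub>v n")
  case False
  then have "A $$ (i, j) = 0 * 0" if "i < n" "j < nc" for i j
    using that A by (metis carrier_matD index_col index_zero_vec(1) mult_zero_left)
  then show thesis by (rule that)
next
  case True
  then obtain l where l: "l < nc" "col A l \<noteq> 0\<^sub>v n" by blast
  define u where "u = col A l"
  have u: "u \<in> carrier_vec n" "u \<in> set (cols A)"
    using A l by (auto simp: u_def cols_def)
  have "\<exists>b. \<forall>i<n. A $$ (i, j) = b * u $ i" if j: "j < nc" for j
  \<comment> \<open>A repeated column is split off because the independence argument counts the set
    \<open>{u, c}\<close>, which must have two elements.\<close>
  proof (cases "col A j = u")
    case True
    then have "A $$ (i, j) = 1 * u $ i" if "i < n" for i
      using A j that by auto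
    then show ?thesis by blast
  next
    case False
    define c where "c = col A j"
    have c: "c \<in> carrier_vec n" "c \<in> set (cols A)" "u \<noteq> c"
      using A j False by (auto simp: c_def cols_def)
    define B where "B = mat_of_cols n [u, c]"
    have B: "B \<in> carrier_mat n 2" by (auto simp: B_def)
    have cols_B: "cols B = [u, c]"
      unfolding B_def using u c by (intro cols_mat_of_cols) auto
    have "lin_dep {u, c}"
    proof (rule ccontr)
      assume "\<not> lin_dep {u, c}"
      then have "card {u, c} \<le> rank A"
        using u c by (intro rank_ge_card_indpt[OF A]) auto
      with rank c show False by simp
    qed
    then obtain w where w: "w \<in> carrier_vec 2" "w \<noteq> 0\<^sub>v 2" "B *\<^sub>v w = 0\<^sub>v n"
      using lin_depE[OF B] cols_B c by auto
    have eq: "u $ i * w $ 0 + c $ i * w $ 1 = 0" if i: "i < n" for i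
    proof -
      have "0 = (B *\<^sub>v w) $ i" using w i by simp
      also have "\<dots> = u $ i * w $ 0 + c $ i * w $ 1"
        using i carrier_vecD[OF w(1)]
        by (simp add: B_def scalar_prod_def mat_of_cols_def numeral_2_eq_2)
      finally show ?thesis by simp
    qed
    have w1: "w $ 1 \<noteq> 0"
    proof
      assume w1: "w $ 1 = 0"
      have "w $ 0 \<noteq> 0"
      proof
        assume "w $ 0 = 0"
        with w1 w(1) have "w = 0\<^sub>v 2"
          by (intro eq_vecI) (auto simp: less_2_cases_iff)
        with w(2) show False ..
      qed
      with eq w1 u have "u = 0\<^sub>v n" by (intro eq_vecI) auto
      with l show False by (simp add: u_def)
    qed
    have "A $$ (i, j) = - (w $ 0 / w $ 1) * u $ i" if i: "i < n" for i
    proof -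
      have "A $$ (i, j) = c $ i" using A i j by (simp add: c_def)
      also have "\<dots> = - (w $ 0 / w $ 1) * u $ i"
        using eq[OF i] w1 by (simp add: field_simps eq_neg_iff_add_eq_0)
      finally show ?thesis .
    qed
    then show ?thesis by blast
  qed
  then obtain b where "\<And>i j. i < n \<Longrightarrow> j < nc \<Longrightarrow> A $$ (i, j) = b j * u $ i"
    by metis
  then show thesis by (rule that)
qed

text \<open>Division with remainder by \<open>p\<close> splits each exponent as
  \<open>i * p + j\<close>; the coefficient splits along with it, so the double sum factors.\<close>

lemma poly_eq_mult_of_coeff_eq:
  fixes N :: "'a::comm_semiring_1 poly"
  assumes deg: "degree N < g * p"
    and coeff: "\<And>i j. i < g \<Longrightarrow> j < p \<Longrightarrow> coeff N (i * p + j) = b j * v i"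
  shows "N = (\<Sum>i<g. monom (v i) (i * p)) * (\<Sum>j<p. monom (b j) j)"
proof -
  have "N = (\<Sum>n<g * p. monom (coeff N n) n)"
    using deg by (intro poly_eqI) (auto simp: coeff_sum coeff_eq_0 not_less)
  also have "\<dots> = (\<Sum>i<g. \<Sum>n = i * p..<i * p + p. monom (coeff N n) n)"
    by (simp only: sum.nat_group)
  also have "\<dots> = (\<Sum>i<g. \<Sum>j<p. monom (v i) (i * p) * monom (b j) j)"
  proof (rule sum.cong[OF refl])
    fix i assume "i \<in> {..<g}"
    then have "(\<Sum>j<p. monom (coeff N (i * p + j)) (i * p + j)) = (\<Sum>j<p. monom (v i) (i * p) * monom (b j) j)"
      by (intro sum.cong) (auto simp: coeff mult_monom mult.commute[of _ "v _"] add.commute[of _ "i * p"])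
    then show "(\<Sum>n = i * p..<i * p + p. monom (coeff N n) n) = (\<Sum>j<p. monom (v i) (i * p) * monom (b j) j)"
      using sum.shift_bounds_nat_ivl[of "\<lambda>n. monom (coeff N n) n" 0 "i * p" p]
      by (simp add: atLeast0LessThan add.commute)
  qed
  finally show ?thesis by (simp add: sum_product)
qed

text \<open>The coefficients of \<open>W\<close> are \<open>p\<close>-th roots of the
  \<open>v i\<close>, and taking \<open>p\<close>-th powers is additive in characteristic
  \<open>p\<close>.\<close>

lemma sum_monom_multiple_char_eq_power:
  fixes v :: "nat \<Rightarrow> 'k::alg_closed_field"
  assumes "prime CHAR('k)"
  obtains W where "(\<Sum>i<g. monom (v i) (i * CHAR('k))) = W ^ CHAR('k)"
proof -
  have "\<exists>r. r ^ CHAR('k) = c" for c :: 'k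
    using assms nth_root_exists prime_gt_0_nat by metis
  then obtain r where r: "\<And>c :: 'k. r c ^ CHAR('k) = c" by metis
  have "(\<Sum>i<g. monom (r (v i)) i) ^ CHAR('k) = (\<Sum>i<g. monom (r (v i)) i ^ CHAR('k))"
    using assms by (intro freshmans_dream_sum) auto
  also have "\<dots> = (\<Sum>i<g. monom (v i) (i * CHAR('k)))"
    by (simp add: monom_power r mult.commute)
  finally show thesis using that by metis
qed

lemma order_power_eq:
  fixes f :: "'a::idom poly"
  assumes "f \<noteq> 0"
  shows "Polynomial.order a (f ^ m) = m * Polynomial.order a f"
  using assms by (induction m) (simp_all add: order_mult)

text \<open>A root of \<open>W\<close> would have order at least \<open>n\<close> in
  \<open>f ^ m\<close>, but a squarefree \<open>f\<close> allows at most \<open>m\<close>.\<close>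

lemma degree_eq_0_of_power_dvd_squarefree_power:
  fixes W f :: "'k::alg_closed_field poly"
  assumes "squarefree f" "f \<noteq> 0" "m < n" "W ^ n dvd f ^ m"
  shows "degree W = 0"
proof (rule ccontr)
  assume "degree W \<noteq> 0"
  then obtain a where "poly W a = 0"
    using alg_closed_imp_poly_has_root by blast
  then have "[:- a, 1:] ^ n dvd f ^ m"
    using assms(4) by (meson dvd_power_same dvd_trans poly_eq_0_iff_dvd)
  then have "n \<le> m * Polynomial.order a f"
    using assms(2) by (simp add: order_divides order_power_eq)
  moreover have "\<not> [:- a, 1:] ^ 2 dvd f"
    using assms(1) by (auto simp: squarefree_def is_unit_iff_degree)
  then have "Polynomial.order a f \<le> 1"
    using assms(2) by (simp add: order_divides)
  then have "m * Polynomial.order a f \<le> m"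
    using mult_le_mono2 by fastforce
  ultimately show False using assms(3) by linarith
qed

theorem theorem3p1:
  fixes p g :: nat
  assumes "prime p" and "odd p" and "g \<ge> p"
    and "CHAR('k::alg_closed_field) = p"
  shows "\<not> (\<exists>f :: 'k poly. hyperelliptic_equation g f \<and> a_number g f = g - 1)"
proof
  assume "\<exists>f :: 'k poly. hyperelliptic_equation g f \<and> a_number g f = g - 1"
  then obtain f :: "'k poly" where sqf: "squarefree f"
    and deg_f: "2 * g + 1 \<le> degree f" "degree f \<le> 2 * g + 2" and a: "a_number g f = g - 1"
    by (auto simp: hyperelliptic_equation_def)
  have f0: "f \<noteq> 0" using deg_f by auto
  have p: "p \<ge> 2" using assms(1) by (rule prime_ge_2_nat)
  define m where "m = (p - 1) div 2"
  have m: "p = 2 * m + 1" "m \<ge> 1"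
    using \<open>odd p\<close> p by (auto simp: m_def elim!: oddE)
  define N where "N = f ^ m"
  have deg_N: "degree N = m * degree f"
    unfolding N_def using f0 by (simp add: degree_power_eq)
  let ?A = "cartier_manin_matrix g f"
  have A: "?A \<in> carrier_mat g g" by (simp add: cartier_manin_matrix_def)
  \<comment> \<open>As \<open>g \<ge> 2\<close>, the value \<open>g - 1\<close> is positive, so the
    truncated difference in \<open>a_number\<close> determines the rank.\<close>
  have "vec_space.rank g ?A \<le> 1"
    using a p \<open>g \<ge> p\<close> by (simp add: a_number_def)
  then obtain v b where vb: "\<And>i j. i < g \<Longrightarrow> j < g \<Longrightarrow> ?A $$ (i, j) = b j * v i"
    using vec_space.rank_le_1_cols_proportional[OF A] by metis
  \<comment> \<open>With indices from 0, column \<open>c\<close> of row \<open>i\<close> holds the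
    exponent \<open>p * (i + 1) - (c + 1)\<close>, so remainder \<open>j\<close> sits in column
    \<open>p - 1 - j\<close>; this column exists because \<open>p \<le> g\<close>.\<close>
  have "coeff N (i * p + j) = b (p - 1 - j) * v i" if "i < g" "j < p" for i j
  proof -
    have "p * (i + 1) - (p - 1 - j + 1) = i * p + j" "p - 1 - j + 1 \<le> p * (i + 1)"
      using that by (auto simp: algebra_simps)
    then have "?A $$ (i, p - 1 - j) = coeff N (i * p + j)"
      using that \<open>g \<ge> p\<close> assms(4)
      by (simp add: cartier_manin_matrix_def cartier_manin_entry_def N_def m_def mult.commute)
    then show ?thesis using vb[of i "p - 1 - j"] that \<open>g \<ge> p\<close> by simp
  qed
  \<comment> \<open>This ensures that the \<open>g\<close> rows reach every exponent of
    \<open>N\<close>. Since \<open>2 * m = p - 1\<close>, the degree is at most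
    \<open>g * p + (p - 1) - g\<close>, and \<open>g \<ge> p\<close> makes this smaller than
    \<open>g * p\<close>.\<close>
  moreover have "degree N < g * p"
  proof -
    have "degree N \<le> m * (2 * g + 2)"
      unfolding deg_N using deg_f(2) by (rule mult_le_mono2)
    also have "\<dots> = g * p + 2 * m - g" using m by (simp add: algebra_simps)
    also have "\<dots> < g * p" using m \<open>g \<ge> p\<close> p by (auto simp: algebra_simps)
    finally show ?thesis .
  qed
  ultimately have N: "N = (\<Sum>i<g. monom (v i) (i * p)) * (\<Sum>j<p. monom (b (p - 1 - j)) j)"
    by (intro poly_eq_mult_of_coeff_eq)
  obtain W where W: "(\<Sum>i<g. monom (v i) (i * p)) = W ^ p"
    using sum_monom_multiple_char_eq_power assms(1,4) by metis
  have "degree W = 0"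
    using sqf f0 m N W
    by (intro degree_eq_0_of_power_dvd_squarefree_power[of f m p]) (auto simp: N_def)
  have "degree N \<le> degree (W ^ p) + degree (\<Sum>j<p. monom (b (p - 1 - j)) j)"
    unfolding N W by (rule degree_mult_le)
  also have "degree (W ^ p) = 0"
    using degree_power_le[of W p] \<open>degree W = 0\<close> by simp
  also have "degree (\<Sum>j<p. monom (b (p - 1 - j)) j) \<le> p - 1"
    by (intro degree_sum_le) (auto intro: order.trans[OF degree_monom_le])
  finally have "m * degree f \<le> 2 * m" using deg_N m by simp
  then have "degree f \<le> 2" using m by simp
  with deg_f p \<open>g \<ge> p\<close> show False by linarith
qed

end
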